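(* Every finitely presented rewriting 2-theory that is monic, terminating and locally commuting-confluent is Mac Lane coherent.
   Context: All compositions are written in diagrammatic order ($f\cdot g$ is $f$ followed by $g$). **Rewriting 2-theories.** $X$ is a fixed countably infinite set of variables. For a graded set $\mathcal{F}=\coprod_n\mathcal{F}_n$ of function symbols, $\mathbb{F}_{\mathcal{F}}(X)$ is the absolutely free term algebra. For a set $\mathcal{E}_{\mathcal{F}}$ of equations between terms, $[t]$ is the class of $t$ modulo the equational theory generated by $\mathcal{E}_{\mathcal{F}}$. A labelled rewriting theory $\langle\mathcal{F};\mathcal{T}\mid\mathcal{E}_{\mathcal{F}}\rangle$ also has a set $\mathcal{T}$ of labelled reduction rules $\tau:[s]\to[t]$ (each label has a unique source and target). Reductions are generated inductively by: identities $1_s:[s]\to[s]$; $F(\varphi_1,\dots,\varphi_n):[F(s_1,\dots,s_n)]\to[F(t_1,\dots,t_n)]$ for $F\in\mathcal{F}_n$ and reductions $\varphi_i:[s_i]\to[t_i]$; $\tau(\varphi_1,\dots,\varphi_n):[s(s_1,\dots,s_n)]\to[t(t_1,\dots,t_n)]$ for a rule $\tau:[s(x_1,\dots,x_n)]\to[t(x_1,\dots,x_n)]$ (of rank $n$); and composites $\varphi\cdot\psi$. A rewriting 2-theory $\mathcal{R}=\langle\mathcal{F};\mathcal{T}\mid\mathcal{E}_{\mathcal{F}};\mathcal{E}_{\mathcal{T}}\rangle$ has in addition a set $\mathcal{E}_{\mathcal{T}}$ of equations between reductions with common source and common target, together with the standard (basic) congruence: identities are units for $\cdot$; $\cdot$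 is associative; $F(\varphi_1,\dots,\varphi_n)\cdot F(\psi_1,\dots,\psi_n)=F(\varphi_1\cdot\psi_1,\dots,\varphi_n\cdot\psi_n)$; and for $\varphi:[s]\to[t]$, $\varphi_i:[s_i]\to[t_i]$: $\varphi(\varphi_1,\dots,\varphi_n)=s(\varphi_1,\dots,\varphi_n)\cdot\varphi(1_{t_1},\dots,1_{t_n})=\varphi(1_{s_1},\dots,1_{s_n})\cdot t(\varphi_1,\dots,\varphi_n)$. $\mathbb{F}(\mathcal{R})$ denotes terms (modulo $\mathcal{E}_{\mathcal{F}}$) and reductions, the latter modulo the smallest congruence (closed under function symbols, rules, composition, substitution) generated by $\mathcal{E}_{\mathcal{T}}$ and the standard congruence. $\mathcal{R}$ is finitely presented if $\mathcal{F},\mathcal{T},\mathcal{E}_{\mathcal{F}},\mathcal{E}_{\mathcal{T}}$ are finite. **Mac Lane coherence.** $\mathrm{Shape}$ commutes with composition, function symbols and rules, and sends every other reduction to $\circ$. $\mathrm{Var}(\alpha)$ is the union of the $\mathrm{Var}$'s of the constituents for composites, function symbols and rules, and is $\{\alpha\}$ otherwise. A reduction $\alpha$ is in general position if $|\mathrm{Var}(\alpha)|$ is maximal among the $|\mathrm{Var}(\tau)|$ for reductions $\tau$ with the same shape. $\mathcal{R}$ is Mac Lane coherent if any two parallel reductions in general position in $\mathbb{F}(\mathcal{R})$ are equal. **Further definitions.** Singular reductions are those $\rho(1_{t_1},\dots,1_{t_n})$ with $\rho\in\mathcal{T}$ of rank $n$, and, inductively, $F(1,\dots,1,\rho,1,\dots,1)$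 with $F\in\mathcal{F}$ and $\rho$ singular. $\mathcal{R}$ is terminating if any infinite sequence of composable singular reductions in $\mathbb{F}(\mathcal{R})$ contains cofinitely many identity reductions. A span in $\mathbb{F}(\mathcal{R})$ is a pair of reductions $u_1\xleftarrow{\varphi_1}s\xrightarrow{\varphi_2}u_2$; it is singular if $\varphi_1,\varphi_2$ are singular; it is commuting-joinable if there are a term $t$ and reductions $\psi_i:u_i\to t$ with $\varphi_1\cdot\psi_1=\varphi_2\cdot\psi_2$ in $\mathbb{F}(\mathcal{R})$. $\mathcal{R}$ is locally commuting-confluent if every singular span in $\mathbb{F}(\mathcal{R})$ is commuting-joinable. $\mathcal{R}$ is monic if whenever $(\varphi_1\cdot\psi,\varphi_2\cdot\psi)\in\mathcal{E}_{\mathcal{T}}$ modulo the basic congruence, also $(\varphi_1,\varphi_2)\in\mathcal{E}_{\mathcal{T}}$.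
   Formalization: "Monic" is taken as right cancellation for equality in F(R) (the full congruence generated by E_T), not just for the listed pairs of E_T modulo the basic congruence; under the latter reading the claim fails (a,b:s→t, h:t→u, c:s→u, E_T={a·h=c, b·h=c}). *)

theory Defs
  imports Main
begin

text \<open>The countably infinite set of variables is \<^typ>\<open>nat\<close>.\<close>

datatype 'f trm = V nat | Fn 'f "'f trm list"

primrec tvars :: "'f trm \<Rightarrow> nat set" where
  "tvars (V x) = {x}"
| "tvars (Fn f ts) = \<Union> (set (map tvars ts))"

primrec tsubst :: "(nat \<Rightarrow> 'f trm) \<Rightarrow> 'f trm \<Rightarrow> 'f trm" where
  "tsubst \<sigma> (V x) = \<sigma> x"
| "tsubst \<sigma> (Fn f ts) = Fn f (map (tsubst \<sigma>) ts)"

text \<open>Syntactic reductions, before typing and before any quotient.  \<open>FunR F [\<phi>\<^sub>1, \<dots>, \<phi>\<^sub>n]\<close> is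
  \<open>F(\<phi>\<^sub>1, \<dots>, \<phi>\<^sub>n)\<close> and \<open>RuleR \<tau> [\<phi>\<^sub>1, \<dots>, \<phi>\<^sub>n]\<close> is \<open>\<tau>(\<phi>\<^sub>1, \<dots>, \<phi>\<^sub>n)\<close>;
  composition is written in diagrammatic order.\<close>

datatype ('f, 'l) red =
    IdR "'f trm"
  | FunR 'f "('f, 'l) red list"
  | RuleR 'l "('f, 'l) red list"
  | CompR "('f, 'l) red" "('f, 'l) red"

text \<open>The graded set of function symbols is \<open>fsyms\<close> with grading \<open>arity\<close>.  A rule of rank \<open>n\<close> has
  its source and target written in the variables \<open>V 0, \<dots>, V (n - 1)\<close>; the names of the variables
  of a rule are immaterial, since rules are only ever used through their instances.\<close>

record ('f, 'l) rw2 =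
  fsyms :: "'f set"
  arity :: "'f \<Rightarrow> nat"
  labels :: "'l set"
  rule_rank :: "'l \<Rightarrow> nat"
  rule_src :: "'l \<Rightarrow> 'f trm"
  rule_tgt :: "'l \<Rightarrow> 'f trm"
  term_eqs :: "('f trm \<times> 'f trm) set"
  red_eqs :: "(('f, 'l) red \<times> ('f, 'l) red) set"

inductive wf_trm :: "('f, 'l) rw2 \<Rightarrow> 'f trm \<Rightarrow> bool" for R where
  "wf_trm R (V x)"
| "\<lbrakk>f \<in> fsyms R; length ts = arity R f; \<forall>t \<in> set ts. wf_trm R t\<rbrakk> \<Longrightarrow> wf_trm R (Fn f ts)"

text \<open>\<open>teq R s t\<close> means \<open>[s] = [t]\<close>.\<close>

inductive teq :: "('f, 'l) rw2 \<Rightarrow> 'f trm \<Rightarrow> 'f trm \<Rightarrow> bool" for R where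
  teq_ax: "\<lbrakk>(s, t) \<in> term_eqs R; \<forall>x. wf_trm R (\<sigma> x)\<rbrakk> \<Longrightarrow> teq R (tsubst \<sigma> s) (tsubst \<sigma> t)"
| teq_refl: "wf_trm R s \<Longrightarrow> teq R s s"
| teq_sym: "teq R s t \<Longrightarrow> teq R t s"
| teq_trans: "\<lbrakk>teq R s t; teq R t u\<rbrakk> \<Longrightarrow> teq R s u"
| teq_cong: "\<lbrakk>f \<in> fsyms R; length ss = arity R f; list_all2 (teq R) ss ts\<rbrakk>
    \<Longrightarrow> teq R (Fn f ss) (Fn f ts)"

text \<open>\<open>is_red R \<phi> s t\<close> means \<open>\<phi> : [s] \<rightarrow> [t]\<close>; the rule \<open>is_red_class\<close> makes it independent of the
  representatives \<open>s\<close> and \<open>t\<close>.  In \<open>is_red_rule\<close>, the term \<open>tsubst ((!) ss) (rule_src R l)\<close> is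
  \<open>s(s\<^sub>1, \<dots>, s\<^sub>n)\<close>.\<close>

inductive is_red :: "('f, 'l) rw2 \<Rightarrow> ('f, 'l) red \<Rightarrow> 'f trm \<Rightarrow> 'f trm \<Rightarrow> bool" for R where
  is_red_id: "wf_trm R s \<Longrightarrow> is_red R (IdR s) s s"
| is_red_fun: "\<lbrakk>f \<in> fsyms R; length \<phi>s = arity R f; length ss = arity R f; length ts = arity R f;
      \<forall>i < arity R f. is_red R (\<phi>s ! i) (ss ! i) (ts ! i)\<rbrakk>
    \<Longrightarrow> is_red R (FunR f \<phi>s) (Fn f ss) (Fn f ts)"
| is_red_rule: "\<lbrakk>l \<in> labels R; length \<phi>s = rule_rank R l; length ss = rule_rank R l;
      length ts = rule_rank R l; \<forall>i < rule_rank R l. is_red R (\<phi>s ! i) (ss ! i) (ts ! i)\<rbrakk>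
    \<Longrightarrow> is_red R (RuleR l \<phi>s) (tsubst ((!) ss) (rule_src R l)) (tsubst ((!) ts) (rule_tgt R l))"
| is_red_comp: "\<lbrakk>is_red R \<phi> s t; is_red R \<psi> t u\<rbrakk> \<Longrightarrow> is_red R (CompR \<phi> \<psi>) s u"
| is_red_class: "\<lbrakk>is_red R \<phi> s t; teq R s s'; teq R t t'\<rbrakk> \<Longrightarrow> is_red R \<phi> s' t'"

definition rewriting_2_theory :: "('f, 'l) rw2 \<Rightarrow> bool" where
  "rewriting_2_theory R \<longleftrightarrow>
     (\<forall>l \<in> labels R. wf_trm R (rule_src R l) \<and> wf_trm R (rule_tgt R l) \<and>
        tvars (rule_src R l) \<union> tvars (rule_tgt R l) \<subseteq> {..<rule_rank R l}) \<and>
     (\<forall>(s, t) \<in> term_eqs R. wf_trm R s \<and> wf_trm R t) \<and>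
     (\<forall>(\<phi>, \<psi>) \<in> red_eqs R. \<exists>s t. is_red R \<phi> s t \<and> is_red R \<psi> s t)"

definition finitely_presented :: "('f, 'l) rw2 \<Rightarrow> bool" where
  "finitely_presented R \<longleftrightarrow>
     finite (fsyms R) \<and> finite (labels R) \<and> finite (term_eqs R) \<and> finite (red_eqs R)"

text \<open>\<open>tapp \<theta> s\<close> is \<open>s(\<theta>\<^sub>1, \<dots>, \<theta>\<^sub>n)\<close> for a term \<open>s\<close> and reductions \<open>\<theta>\<^sub>i\<close>.\<close>

primrec tapp :: "(nat \<Rightarrow> ('f, 'l) red) \<Rightarrow> 'f trm \<Rightarrow> ('f, 'l) red" where
  "tapp \<theta> (V x) = \<theta> x"
| "tapp \<theta> (Fn f ts) = FunR f (map (tapp \<theta>) ts)"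

text \<open>\<open>rsubst b \<phi> \<theta>\<close> is \<open>\<phi>(\<theta>\<^sub>1, \<dots>, \<theta>\<^sub>n)\<close> for \<open>\<theta>\<^sub>i : [a\<^sub>i] \<rightarrow> [b\<^sub>i]\<close>.  On a composite, the \<open>\<theta>\<^sub>i\<close> go to the
  first factor and the identities of the \<open>b\<^sub>i\<close> to the second; by the interchange laws below, putting
  the \<open>\<theta>\<^sub>i\<close> in the second factor and the identities of the \<open>a\<^sub>i\<close> in the first gives an equal
  reduction.\<close>

primrec rsubst ::
  "(nat \<Rightarrow> 'f trm) \<Rightarrow> ('f, 'l) red \<Rightarrow> (nat \<Rightarrow> ('f, 'l) red) \<Rightarrow> ('f, 'l) red" where
  "rsubst b (IdR s) = (\<lambda>\<theta>. tapp \<theta> s)"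
| "rsubst b (FunR f \<phi>s) = (\<lambda>\<theta>. FunR f (map (\<lambda>g. g \<theta>) (map (rsubst b) \<phi>s)))"
| "rsubst b (RuleR l \<phi>s) = (\<lambda>\<theta>. RuleR l (map (\<lambda>g. g \<theta>) (map (rsubst b) \<phi>s)))"
| "rsubst b (CompR \<phi> \<psi>) = (\<lambda>\<theta>. CompR (rsubst b \<phi> \<theta>) (rsubst b \<psi> (\<lambda>x. IdR (b x))))"

text \<open>\<open>red_eq R \<phi> \<psi>\<close> is equality of \<open>\<phi>\<close> and \<open>\<psi>\<close> in \<open>\<FF>(R)\<close>: the smallest congruence containing the
  given equations (\<open>req_ax\<close>) and the standard congruence.  The rule \<open>req_id_class\<close> says that the identity of
  \<open>[s]\<close> depends only on the class \<open>[s]\<close>; \<open>req_fun_id\<close> is functoriality of function symbols on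
  identities, so that \<open>s(1, \<dots>, 1)\<close> is the identity.\<close>

inductive red_eq :: "('f, 'l) rw2 \<Rightarrow> ('f, 'l) red \<Rightarrow> ('f, 'l) red \<Rightarrow> bool" for R where
  req_ax: "(\<phi>, \<psi>) \<in> red_eqs R \<Longrightarrow> red_eq R \<phi> \<psi>"
| req_refl: "is_red R \<phi> s t \<Longrightarrow> red_eq R \<phi> \<phi>"
| req_sym: "red_eq R \<phi> \<psi> \<Longrightarrow> red_eq R \<psi> \<phi>"
| req_trans: "\<lbrakk>red_eq R \<phi> \<psi>; red_eq R \<psi> \<chi>\<rbrakk> \<Longrightarrow> red_eq R \<phi> \<chi>"
| req_fun_cong: "\<lbrakk>f \<in> fsyms R; length \<phi>s = arity R f; list_all2 (red_eq R) \<phi>s \<psi>s\<rbrakk>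
    \<Longrightarrow> red_eq R (FunR f \<phi>s) (FunR f \<psi>s)"
| req_rule_cong: "\<lbrakk>l \<in> labels R; length \<phi>s = rule_rank R l; list_all2 (red_eq R) \<phi>s \<psi>s\<rbrakk>
    \<Longrightarrow> red_eq R (RuleR l \<phi>s) (RuleR l \<psi>s)"
| req_comp_cong: "\<lbrakk>is_red R \<phi> s t; is_red R \<psi> t u; red_eq R \<phi> \<phi>'; red_eq R \<psi> \<psi>'\<rbrakk>
    \<Longrightarrow> red_eq R (CompR \<phi> \<psi>) (CompR \<phi>' \<psi>')"
| req_subst_cong: "\<lbrakk>red_eq R \<phi> \<psi>; \<forall>x. is_red R (\<theta> x) (a x) (b x)\<rbrakk>
    \<Longrightarrow> red_eq R (rsubst b \<phi> \<theta>) (rsubst b \<psi> \<theta>)"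
| req_id_class: "teq R s s' \<Longrightarrow> red_eq R (IdR s) (IdR s')"
| req_id_left: "is_red R \<phi> s t \<Longrightarrow> red_eq R (CompR (IdR s) \<phi>) \<phi>"
| req_id_right: "is_red R \<phi> s t \<Longrightarrow> red_eq R (CompR \<phi> (IdR t)) \<phi>"
| req_assoc: "\<lbrakk>is_red R \<phi> s t; is_red R \<psi> t u; is_red R \<chi> u v\<rbrakk>
    \<Longrightarrow> red_eq R (CompR (CompR \<phi> \<psi>) \<chi>) (CompR \<phi> (CompR \<psi> \<chi>))"
| req_fun_id: "\<lbrakk>f \<in> fsyms R; length ss = arity R f; \<forall>s \<in> set ss. wf_trm R s\<rbrakk>
    \<Longrightarrow> red_eq R (FunR f (map IdR ss)) (IdR (Fn f ss))"
| req_fun_comp: "\<lbrakk>f \<in> fsyms R; length \<phi>s = arity R f; length \<psi>s = arity R f;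
      \<forall>i < arity R f. \<exists>s t u. is_red R (\<phi>s ! i) s t \<and> is_red R (\<psi>s ! i) t u\<rbrakk>
    \<Longrightarrow> red_eq R (CompR (FunR f \<phi>s) (FunR f \<psi>s)) (FunR f (map2 CompR \<phi>s \<psi>s))"
| req_interchange_src: "\<lbrakk>is_red R \<phi> s t; \<forall>x. is_red R (\<theta> x) (a x) (b x)\<rbrakk>
    \<Longrightarrow> red_eq R (rsubst b \<phi> \<theta>) (CompR (tapp \<theta> s) (rsubst b \<phi> (\<lambda>x. IdR (b x))))"
| req_interchange_tgt: "\<lbrakk>is_red R \<phi> s t; \<forall>x. is_red R (\<theta> x) (a x) (b x)\<rbrakk>
    \<Longrightarrow> red_eq R (rsubst b \<phi> \<theta>) (CompR (rsubst a \<phi> (\<lambda>x. IdR (a x))) (tapp \<theta> t))"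

text \<open>Shape and Var depend on the way a reduction is built, so they are defined on syntactic
  reductions; the only reductions that are not composites, function symbols or rules are the
  identities.  The element of \<open>red_vars R (IdR s)\<close> is the identity of the class \<open>[s]\<close>,
  represented by that class.\<close>

datatype ('f, 'l) rshape =
    Circ
  | FunS 'f "('f, 'l) rshape list"
  | RuleS 'l "('f, 'l) rshape list"
  | CompS "('f, 'l) rshape" "('f, 'l) rshape"

primrec shape :: "('f, 'l) red \<Rightarrow> ('f, 'l) rshape" where
  "shape (IdR s) = Circ"
| "shape (FunR f \<phi>s) = FunS f (map shape \<phi>s)"
| "shape (RuleR l \<phi>s) = RuleS l (map shape \<phi>s)"
| "shape (CompR \<phi> \<psi>) = CompS (shape \<phi>) (shape \<psi>)"

primrec red_vars :: "('f, 'l) rw2 \<Rightarrow> ('f, 'l) red \<Rightarrow> 'f trm set set" where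
  "red_vars R (IdR s) = {{t. teq R s t}}"
| "red_vars R (FunR f \<phi>s) = \<Union> (set (map (red_vars R) \<phi>s))"
| "red_vars R (RuleR l \<phi>s) = \<Union> (set (map (red_vars R) \<phi>s))"
| "red_vars R (CompR \<phi> \<psi>) = red_vars R \<phi> \<union> red_vars R \<psi>"

definition general_position :: "('f, 'l) rw2 \<Rightarrow> ('f, 'l) red \<Rightarrow> bool" where
  "general_position R \<alpha> \<longleftrightarrow>
     (\<forall>\<tau> s t. is_red R \<tau> s t \<and> shape \<tau> = shape \<alpha> \<longrightarrow> card (red_vars R \<tau>) \<le> card (red_vars R \<alpha>))"

definition mac_lane_coherent :: "('f, 'l) rw2 \<Rightarrow> bool" where
  "mac_lane_coherent R \<longleftrightarrow>
     (\<forall>\<phi> \<psi> s t. is_red R \<phi> s t \<and> is_red R \<psi> s t \<and> general_position R \<phi> \<and> general_position R \<psi>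
        \<longrightarrow> red_eq R \<phi> \<psi>)"

inductive singular :: "('f, 'l) rw2 \<Rightarrow> ('f, 'l) red \<Rightarrow> bool" for R where
  singular_rule: "\<lbrakk>l \<in> labels R; length ts = rule_rank R l; \<forall>t \<in> set ts. wf_trm R t\<rbrakk>
    \<Longrightarrow> singular R (RuleR l (map IdR ts))"
| singular_fun: "\<lbrakk>f \<in> fsyms R; length ss + 1 + length ts = arity R f;
      \<forall>t \<in> set ss \<union> set ts. wf_trm R t; singular R \<rho>\<rbrakk>
    \<Longrightarrow> singular R (FunR f (map IdR ss @ [\<rho>] @ map IdR ts))"

text \<open>A singular reduction is an identity in \<open>\<FF>(R)\<close> if the equations make it equal to one.\<close>

definition is_identity :: "('f, 'l) rw2 \<Rightarrow> ('f, 'l) red \<Rightarrow> bool" where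
  "is_identity R \<phi> \<longleftrightarrow> (\<exists>s. wf_trm R s \<and> red_eq R \<phi> (IdR s))"

definition terminating :: "('f, 'l) rw2 \<Rightarrow> bool" where
  "terminating R \<longleftrightarrow>
     (\<forall>\<phi> t. (\<forall>n. singular R (\<phi> n) \<and> is_red R (\<phi> n) (t n) (t (Suc n)))
        \<longrightarrow> finite {n::nat. \<not> is_identity R (\<phi> n)})"

definition commuting_joinable ::
  "('f, 'l) rw2 \<Rightarrow> ('f, 'l) red \<Rightarrow> 'f trm \<Rightarrow> ('f, 'l) red \<Rightarrow> 'f trm \<Rightarrow> bool" where
  "commuting_joinable R \<phi>\<^sub>1 u\<^sub>1 \<phi>\<^sub>2 u\<^sub>2 \<longleftrightarrow>
     (\<exists>t \<psi>\<^sub>1 \<psi>\<^sub>2. is_red R \<psi>\<^sub>1 u\<^sub>1 t \<and> is_red R \<psi>\<^sub>2 u\<^sub>2 t \<and> red_eq R (CompR \<phi>\<^sub>1 \<psi>\<^sub>1) (CompR \<phi>\<^sub>2 \<psi>\<^sub>2))"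

definition locally_commuting_confluent :: "('f, 'l) rw2 \<Rightarrow> bool" where
  "locally_commuting_confluent R \<longleftrightarrow>
     (\<forall>\<phi>\<^sub>1 \<phi>\<^sub>2 s u\<^sub>1 u\<^sub>2. is_red R \<phi>\<^sub>1 s u\<^sub>1 \<and> is_red R \<phi>\<^sub>2 s u\<^sub>2 \<and> singular R \<phi>\<^sub>1 \<and> singular R \<phi>\<^sub>2
        \<longrightarrow> commuting_joinable R \<phi>\<^sub>1 u\<^sub>1 \<phi>\<^sub>2 u\<^sub>2)"

text \<open>Being in the set of equations modulo the basic congruence is read as \<^const>\<open>red_eq\<close>, the
  congruence which the equations generate on top of the basic one; so monic means that every
  reduction can be cancelled on the right in \<open>\<FF>(R)\<close>.  If only the pairs listed in \<^const>\<open>red_eqs\<close>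
  were considered, the property would not exclude \<open>a, b : s \<rightarrow> t\<close>, \<open>h : t \<rightarrow> u\<close>, \<open>c : s \<rightarrow> u\<close> (rules
  between constants) with the two equations \<open>a \<cdot> h = c\<close> and \<open>b \<cdot> h = c\<close>, which is terminating and
  locally commuting-confluent but has \<open>a \<noteq> b\<close>.\<close>

definition monic :: "('f, 'l) rw2 \<Rightarrow> bool" where
  "monic R \<longleftrightarrow>
     (\<forall>\<phi>\<^sub>1 \<phi>\<^sub>2 \<psi> s t u. is_red R \<phi>\<^sub>1 s t \<and> is_red R \<phi>\<^sub>2 s t \<and> is_red R \<psi> t u \<and>
        red_eq R (CompR \<phi>\<^sub>1 \<psi>) (CompR \<phi>\<^sub>2 \<psi>) \<longrightarrow> red_eq R \<phi>\<^sub>1 \<phi>\<^sub>2)"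

end

theory Submission
  imports Defs
begin

text \<open>Every reduction decomposes into singular ones, so in a terminating theory a reduction is either
  an identity or starts with a non-identity singular step.  Well-founded induction along such steps
  (Newman's argument, with the joining diagrams commuting) shows that any two reductions from \<open>s\<close> to
  normal forms are equal, and in particular have the same target.  Given parallel
  \<open>\<phi>, \<psi> : s \<rightarrow> t\<close>, compose both with a reduction from \<open>t\<close> to a normal form and cancel it by
  monicity.\<close>

lemma tsubst_cong: "(\<And>x. x \<in> tvars s \<Longrightarrow> \<sigma> x = \<tau> x) \<Longrightarrow> tsubst \<sigma> s = tsubst \<tau> s"
  by (induction s) auto

lemma tsubst_tsubst: "tsubst \<tau> (tsubst \<sigma> s) = tsubst (\<lambda>x. tsubst \<tau> (\<sigma> x)) s"
  by (induction s) auto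

lemma tsubst_V [simp]: "tsubst V s = s"
  by (induction s) (auto intro: map_idI)

lemma wf_trm_Fn [simp]:
  "wf_trm R (Fn f ts) \<longleftrightarrow> f \<in> fsyms R \<and> length ts = arity R f \<and> (\<forall>t\<in>set ts. wf_trm R t)"
  by (auto elim: wf_trm.cases intro: wf_trm.intros)

lemma wf_trm_tsubst:
  "wf_trm R s \<Longrightarrow> (\<And>x. x \<in> tvars s \<Longrightarrow> wf_trm R (\<sigma> x)) \<Longrightarrow> wf_trm R (tsubst \<sigma> s)"
  by (induction s) auto

lemma teq_tsubst_cong:
  "wf_trm R s \<Longrightarrow> (\<And>x. x \<in> tvars s \<Longrightarrow> teq R (\<sigma> x) (\<tau> x))
    \<Longrightarrow> teq R (tsubst \<sigma> s) (tsubst \<tau> s)"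
proof (induction s)
  case (Fn f ts)
  then show ?case
    by (auto intro!: teq_cong simp: list_all2_conv_all_nth) (metis UN_I nth_mem)
qed simp

lemma tapp_typing:
  "wf_trm R s \<Longrightarrow> (\<And>x. x \<in> tvars s \<Longrightarrow> is_red R (\<theta> x) (a x) (b x))
    \<Longrightarrow> is_red R (tapp \<theta> s) (tsubst a s) (tsubst b s)"
proof (induction s)
  case (Fn f ts)
  then show ?case
    by (auto intro!: is_red_fun) (metis UN_I nth_mem)
qed simp

context
  fixes R :: "('f, 'l) rw2"
  assumes R: "rewriting_2_theory R"
begin

lemma rule_wf:
  assumes "l \<in> labels R"
  shows "wf_trm R (rule_src R l)" "wf_trm R (rule_tgt R l)"
    "\<And>x. x \<in> tvars (rule_src R l) \<Longrightarrow> x < rule_rank R l"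
    "\<And>x. x \<in> tvars (rule_tgt R l) \<Longrightarrow> x < rule_rank R l"
  using R assms unfolding rewriting_2_theory_def by blast+

lemma teq_wf: "teq R s t \<Longrightarrow> wf_trm R s \<and> wf_trm R t"
proof (induction rule: teq.induct)
  case (teq_ax s t \<sigma>)
  then have "wf_trm R s" "wf_trm R t"
    using R unfolding rewriting_2_theory_def by blast+
  with teq_ax show ?case by (simp add: wf_trm_tsubst)
next
  case (teq_cong f ss ts)
  then show ?case by (auto simp: list_all2_conv_all_nth in_set_conv_nth)
qed auto

lemma is_red_wf: "is_red R \<phi> s t \<Longrightarrow> wf_trm R s \<and> wf_trm R t"
proof (induction rule: is_red.induct)
  case (is_red_fun f \<phi>s ss ts)
  then show ?case by (auto simp: in_set_conv_nth)
next
  case (is_red_rule l \<phi>s ss ts)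
  then show ?case
    using rule_wf[of l] by (auto intro!: wf_trm_tsubst)
qed (auto dest: teq_wf)

lemma teq_tsubst:
  "teq R s t \<Longrightarrow> (\<And>x. wf_trm R (\<tau> x)) \<Longrightarrow> teq R (tsubst \<tau> s) (tsubst \<tau> t)"
proof (induction rule: teq.induct)
  case (teq_ax s t \<sigma>)
  then show ?case
    unfolding tsubst_tsubst by (intro teq.teq_ax) (auto intro: wf_trm_tsubst)
next
  case (teq_cong f ss ts)
  then show ?case
    by (auto intro!: teq.teq_cong simp: list_all2_conv_all_nth)
qed (auto intro: teq.intros wf_trm_tsubst)

lemma is_red_IdE: "is_red R (IdR w) s t \<Longrightarrow> teq R w s \<and> teq R w t"
proof (induction "IdR w :: ('f, 'l) red" s t rule: is_red.induct)
  case is_red_id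
  then show ?case by (auto intro: teq_refl)
next
  case is_red_class
  then show ?case by (auto intro: teq_trans)
qed

lemma is_red_FunE:
  "is_red R (FunR f \<phi>s) s t \<Longrightarrow> \<exists>ss ts. f \<in> fsyms R \<and> length \<phi>s = arity R f
    \<and> length ss = arity R f \<and> length ts = arity R f
    \<and> (\<forall>i<arity R f. is_red R (\<phi>s ! i) (ss ! i) (ts ! i))
    \<and> teq R (Fn f ss) s \<and> teq R (Fn f ts) t"
proof (induction "FunR f \<phi>s" s t rule: is_red.induct)
  case (is_red_fun ss ts)
  then have "is_red R (FunR f \<phi>s) (Fn f ss) (Fn f ts)"
    by (auto intro: is_red.is_red_fun)
  then have "teq R (Fn f ss) (Fn f ss)" "teq R (Fn f ts) (Fn f ts)"
    using is_red_wf teq_refl by blast+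
  with is_red_fun show ?case by blast
next
  case is_red_class
  then show ?case by (meson teq_trans)
qed

lemma is_red_RuleE:
  "is_red R (RuleR l \<phi>s) s t \<Longrightarrow> \<exists>ss ts. l \<in> labels R \<and> length \<phi>s = rule_rank R l
    \<and> length ss = rule_rank R l \<and> length ts = rule_rank R l
    \<and> (\<forall>i<rule_rank R l. is_red R (\<phi>s ! i) (ss ! i) (ts ! i))
    \<and> teq R (tsubst ((!) ss) (rule_src R l)) s \<and> teq R (tsubst ((!) ts) (rule_tgt R l)) t"
proof (induction "RuleR l \<phi>s" s t rule: is_red.induct)
  case (is_red_rule ss ts)
  then have "is_red R (RuleR l \<phi>s) (tsubst ((!) ss) (rule_src R l)) (tsubst ((!) ts) (rule_tgt R l))"
    by (auto intro: is_red.is_red_rule)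
  then have "teq R (tsubst ((!) ss) (rule_src R l)) (tsubst ((!) ss) (rule_src R l))"
    "teq R (tsubst ((!) ts) (rule_tgt R l)) (tsubst ((!) ts) (rule_tgt R l))"
    using is_red_wf teq_refl by blast+
  with is_red_rule show ?case by blast
next
  case is_red_class
  then show ?case by (meson teq_trans)
qed

lemma is_red_CompE:
  "is_red R (CompR \<phi> \<psi>) s u \<Longrightarrow> \<exists>t. is_red R \<phi> s t \<and> is_red R \<psi> t u"
proof (induction "CompR \<phi> \<psi>" s u rule: is_red.induct)
  case (is_red_class s u s' u')
  then obtain t where t: "is_red R \<phi> s t" "is_red R \<psi> t u" by blast
  then have "teq R t t" using is_red_wf teq_refl by blast
  with t is_red_class show ?case by (meson is_red.is_red_class)
qed blast

lemma is_red_unique: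
  "is_red R \<phi> s t \<Longrightarrow> is_red R \<phi> s' t' \<Longrightarrow> teq R s s' \<and> teq R t t'"
proof (induction \<phi> arbitrary: s t s' t')
  case (IdR w)
  then show ?case by (meson is_red_IdE teq_sym teq_trans)
next
  case (FunR f \<phi>s)
  obtain ss ts where 1: "f \<in> fsyms R" "length \<phi>s = arity R f" "length ss = arity R f"
    "length ts = arity R f" "\<forall>i<arity R f. is_red R (\<phi>s ! i) (ss ! i) (ts ! i)"
    "teq R (Fn f ss) s" "teq R (Fn f ts) t"
    using is_red_FunE[OF FunR.prems(1)] by blast
  obtain ss' ts' where 2: "length ss' = arity R f" "length ts' = arity R f"
    "\<forall>i<arity R f. is_red R (\<phi>s ! i) (ss' ! i) (ts' ! i)"
    "teq R (Fn f ss') s'" "teq R (Fn f ts') t'"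
    using is_red_FunE[OF FunR.prems(2)] by blast
  have "\<forall>i<arity R f. teq R (ss ! i) (ss' ! i) \<and> teq R (ts ! i) (ts' ! i)"
    using 1 2 FunR.IH by (metis nth_mem)
  with 1 2 have "teq R (Fn f ss) (Fn f ss')" "teq R (Fn f ts) (Fn f ts')"
    by (auto intro!: teq_cong simp: list_all2_conv_all_nth)
  with 1 2 show ?case by (meson teq_sym teq_trans)
next
  case (RuleR l \<phi>s)
  obtain ss ts where 1: "l \<in> labels R" "length \<phi>s = rule_rank R l"
    "\<forall>i<rule_rank R l. is_red R (\<phi>s ! i) (ss ! i) (ts ! i)"
    "teq R (tsubst ((!) ss) (rule_src R l)) s" "teq R (tsubst ((!) ts) (rule_tgt R l)) t"
    using is_red_RuleE[OF RuleR.prems(1)] by blast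
  obtain ss' ts' where 2: "\<forall>i<rule_rank R l. is_red R (\<phi>s ! i) (ss' ! i) (ts' ! i)"
    "teq R (tsubst ((!) ss') (rule_src R l)) s'" "teq R (tsubst ((!) ts') (rule_tgt R l)) t'"
    using is_red_RuleE[OF RuleR.prems(2)] by blast
  have "\<forall>i<rule_rank R l. teq R (ss ! i) (ss' ! i) \<and> teq R (ts ! i) (ts' ! i)"
    using 1 2 RuleR.IH by (metis nth_mem)
  then have "teq R (tsubst ((!) ss) (rule_src R l)) (tsubst ((!) ss') (rule_src R l))"
    "teq R (tsubst ((!) ts) (rule_tgt R l)) (tsubst ((!) ts') (rule_tgt R l))"
    using rule_wf[OF 1(1)] by (auto intro!: teq_tsubst_cong)
  with 1 2 show ?case by (meson teq_sym teq_trans)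
next
  case (CompR \<phi> \<psi>)
  then show ?case by (meson is_red_CompE)
qed

lemma is_red_retype:
  "is_red R \<phi> s t \<Longrightarrow> is_red R \<psi> s' t' \<Longrightarrow> is_red R \<psi> s t \<Longrightarrow> is_red R \<phi> s' t'"
  by (meson is_red_class is_red_unique)

lemma is_red_change_src: "is_red R \<phi> s t \<Longrightarrow> teq R s s' \<Longrightarrow> is_red R \<phi> s' t"
  by (meson is_red_class is_red_wf teq_refl)

lemma is_red_change_tgt: "is_red R \<phi> s t \<Longrightarrow> teq R t t' \<Longrightarrow> is_red R \<phi> s t'"
  by (meson is_red_class is_red_wf teq_refl)

lemma is_red_IdR: "teq R s t \<Longrightarrow> is_red R (IdR s) s t"
  by (meson is_red_change_tgt is_red_id teq_wf)

lemma rsubst_typing: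
  "is_red R \<phi> s t \<Longrightarrow> (\<And>x. is_red R (\<theta> x) (a x) (b x))
    \<Longrightarrow> is_red R (rsubst b \<phi> \<theta>) (tsubst a s) (tsubst b t)"
proof (induction arbitrary: \<theta> a rule: is_red.induct)
  case (is_red_id s)
  then show ?case by (auto intro: tapp_typing)
next
  case (is_red_fun f \<phi>s ss ts)
  then show ?case by (auto intro!: is_red.is_red_fun)
next
  case (is_red_rule l \<phi>s ss ts)
  have "is_red R (RuleR l (map (\<lambda>\<phi>. rsubst b \<phi> \<theta>) \<phi>s))
      (tsubst ((!) (map (tsubst a) ss)) (rule_src R l))
      (tsubst ((!) (map (tsubst b) ts)) (rule_tgt R l))"
    using is_red_rule by (intro is_red.is_red_rule) auto
  moreover have "tsubst ((!) (map (tsubst a) ss)) (rule_src R l)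
      = tsubst a (tsubst ((!) ss) (rule_src R l))"
    "tsubst ((!) (map (tsubst b) ts)) (rule_tgt R l) = tsubst b (tsubst ((!) ts) (rule_tgt R l))"
    unfolding tsubst_tsubst using is_red_rule rule_wf[of l] by (auto intro!: tsubst_cong)
  ultimately show ?case by (simp add: comp_def)
next
  case (is_red_comp \<phi> s t \<psi> u)
  have "is_red R (IdR (b x)) (b x) (b x)" for x
    using is_red_comp.prems is_red_wf is_red.is_red_id by blast
  then have "is_red R (rsubst b \<psi> (\<lambda>x. IdR (b x))) (tsubst b t) (tsubst b u)"
    by (rule is_red_comp.IH(2))
  with is_red_comp.IH(1)[OF is_red_comp.prems] show ?case by (simp add: is_red.is_red_comp)
next
  case (is_red_class \<phi> s t s' t')
  then have "wf_trm R (a x)" "wf_trm R (b x)" for x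
    using is_red_wf by blast+
  with is_red_class show ?case by (meson is_red.is_red_class teq_tsubst)
qed

lemma red_eq_typing: "red_eq R \<phi> \<psi> \<Longrightarrow> \<exists>s t. is_red R \<phi> s t \<and> is_red R \<psi> s t"
proof (induction rule: red_eq.induct)
  case (req_ax \<phi> \<psi>)
  then show ?case using R unfolding rewriting_2_theory_def by blast
next
  case (req_trans \<phi> \<psi> \<chi>)
  then show ?case by (meson is_red_retype)
next
  case (req_fun_cong f \<phi>s \<psi>s)
  have "\<forall>i. \<exists>s t. i < arity R f \<longrightarrow> is_red R (\<phi>s ! i) s t \<and> is_red R (\<psi>s ! i) s t"
    using req_fun_cong by (auto simp: list_all2_conv_all_nth)
  then obtain S T where "\<And>i. i < arity R f \<Longrightarrow> is_red R (\<phi>s ! i) (S i) (T i) \<and> is_red R (\<psi>s ! i) (S i) (T i)"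
    by metis
  then have "is_red R (FunR f \<chi>s) (Fn f (map S [0..<arity R f])) (Fn f (map T [0..<arity R f]))"
    if "\<chi>s \<in> {\<phi>s, \<psi>s}" for \<chi>s
    using req_fun_cong that by (intro is_red_fun) (auto dest: list_all2_lengthD)
  then show ?case by blast
next
  case (req_rule_cong l \<phi>s \<psi>s)
  have "\<forall>i. \<exists>s t. i < rule_rank R l \<longrightarrow> is_red R (\<phi>s ! i) s t \<and> is_red R (\<psi>s ! i) s t"
    using req_rule_cong by (auto simp: list_all2_conv_all_nth)
  then obtain S T where
    "\<And>i. i < rule_rank R l \<Longrightarrow> is_red R (\<phi>s ! i) (S i) (T i) \<and> is_red R (\<psi>s ! i) (S i) (T i)"
    by metis
  then have "is_red R (RuleR l \<chi>s) (tsubst ((!) (map S [0..<rule_rank R l])) (rule_src R l))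
      (tsubst ((!) (map T [0..<rule_rank R l])) (rule_tgt R l))"
    if "\<chi>s \<in> {\<phi>s, \<psi>s}" for \<chi>s
    using req_rule_cong that by (intro is_red_rule) (auto dest: list_all2_lengthD)
  then show ?case by blast
next
  case (req_comp_cong \<phi> s t \<psi> u \<phi>' \<psi>')
  then have "is_red R \<phi>' s t" "is_red R \<psi>' t u"
    by (meson is_red_retype)+
  with req_comp_cong show ?case by (meson is_red_comp)
next
  case (req_subst_cong \<phi> \<psi> \<theta> a b)
  then obtain s t where "is_red R \<phi> s t" "is_red R \<psi> s t" by blast
  with req_subst_cong.hyps show ?case by (blast intro: rsubst_typing)
next
  case (req_id_class s s')
  then have "is_red R (IdR s) s s" "is_red R (IdR s') s s"
    using is_red_IdR is_red_change_tgt teq_sym teq_wf is_red_id is_red_class by meson+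
  then show ?case by blast
next
  case (req_id_left \<phi> s t)
  then show ?case by (meson is_red_wf is_red_comp is_red_id)
next
  case (req_id_right \<phi> s t)
  then show ?case by (meson is_red_wf is_red_comp is_red_id)
next
  case (req_assoc \<phi> s t \<psi> u \<chi> v)
  then show ?case by (meson is_red_comp)
next
  case (req_fun_id f ss)
  then have "is_red R (FunR f (map IdR ss)) (Fn f ss) (Fn f ss)"
    by (auto intro!: is_red_fun is_red_id)
  moreover have "is_red R (IdR (Fn f ss)) (Fn f ss) (Fn f ss)"
    using req_fun_id by (intro is_red_id) auto
  ultimately show ?case by blast
next
  case (req_fun_comp f \<phi>s \<psi>s)
  then obtain S T U where STU:
    "\<And>i. i < arity R f \<Longrightarrow> is_red R (\<phi>s ! i) (S i) (T i) \<and> is_red R (\<psi>s ! i) (T i) (U i)"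
    by metis
  then have comp: "\<And>i. i < arity R f \<Longrightarrow> is_red R (CompR (\<phi>s ! i) (\<psi>s ! i)) (S i) (U i)"
    using is_red_comp by blast
  define n where "n = arity R f"
  have "is_red R (FunR f \<phi>s) (Fn f (map S [0..<n])) (Fn f (map T [0..<n]))"
    "is_red R (FunR f \<psi>s) (Fn f (map T [0..<n])) (Fn f (map U [0..<n]))"
    "is_red R (FunR f (map2 CompR \<phi>s \<psi>s)) (Fn f (map S [0..<n])) (Fn f (map U [0..<n]))"
    using req_fun_comp.hyps STU comp by (auto intro!: is_red_fun simp: n_def)
  then show ?case by (meson is_red_comp)
next
  case (req_interchange_src \<phi> s t \<theta> a b)
  have "is_red R (IdR (b x)) (b x) (b x)" for x
    using req_interchange_src is_red_wf is_red_id by blast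
  then have "is_red R (rsubst b \<phi> (\<lambda>x. IdR (b x))) (tsubst b s) (tsubst b t)"
    "is_red R (rsubst b \<phi> \<theta>) (tsubst a s) (tsubst b t)"
    "is_red R (tapp \<theta> s) (tsubst a s) (tsubst b s)"
    using req_interchange_src by (simp_all add: rsubst_typing tapp_typing is_red_wf[THEN conjunct1])
  then show ?case by (blast intro: is_red_comp)
next
  case (req_interchange_tgt \<phi> s t \<theta> a b)
  have "is_red R (IdR (a x)) (a x) (a x)" for x
    using req_interchange_tgt is_red_wf is_red_id by blast
  then have "is_red R (rsubst a \<phi> (\<lambda>x. IdR (a x))) (tsubst a s) (tsubst a t)"
    "is_red R (rsubst b \<phi> \<theta>) (tsubst a s) (tsubst b t)"
    "is_red R (tapp \<theta> t) (tsubst a t) (tsubst b t)"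
    using req_interchange_tgt by (simp_all add: rsubst_typing tapp_typing is_red_wf[THEN conjunct2])
  then show ?case by (blast intro: is_red_comp)
qed blast+

lemma red_eq_is_red: "red_eq R \<phi> \<psi> \<Longrightarrow> is_red R \<phi> s t \<Longrightarrow> is_red R \<psi> s t"
  by (meson red_eq_typing is_red_retype)

inductive singular_generated :: "('f, 'l) red \<Rightarrow> bool" where
  sgen_id: "wf_trm R s \<Longrightarrow> singular_generated (IdR s)"
| sgen_singular: "is_red R \<rho> s t \<Longrightarrow> singular R \<rho> \<Longrightarrow> singular_generated \<rho>"
| sgen_comp: "is_red R \<phi> s t \<Longrightarrow> is_red R \<psi> t u \<Longrightarrow> singular_generated \<phi> \<Longrightarrow> singular_generated \<psi>
    \<Longrightarrow> singular_generated (CompR \<phi> \<psi>)"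
| sgen_eq: "red_eq R \<phi> \<psi> \<Longrightarrow> singular_generated \<phi> \<Longrightarrow> singular_generated \<psi>"

lemma FunR_context_comp:
  assumes f: "f \<in> fsyms R" "length ss + 1 + length ts = arity R f"
    "\<forall>t\<in>set ss \<union> set ts. wf_trm R t"
    and c: "is_red R \<phi> s t" "is_red R \<psi> t u"
  shows "red_eq R (CompR (FunR f (map IdR ss @ [\<phi>] @ map IdR ts)) (FunR f (map IdR ss @ [\<psi>] @ map IdR ts)))
    (FunR f (map IdR ss @ [CompR \<phi> \<psi>] @ map IdR ts))"
proof -
  let ?C = "\<lambda>\<chi>. map IdR ss @ [\<chi>] @ map IdR ts"
  have "is_red R (?C \<chi> ! i) ((ss @ [s] @ ts) ! i) ((ss @ [t] @ ts) ! i)"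
    if "is_red R \<chi> s t" "i < arity R f" for \<chi> s t i
    using f that by (auto simp: nth_append nth_Cons' intro!: is_red_id)
  from this[OF c(1)] this[OF c(2)]
  have "\<exists>s t u. is_red R (?C \<phi> ! i) s t \<and> is_red R (?C \<psi> ! i) t u" if "i < arity R f" for i
    using that by blast
  then have "red_eq R (CompR (FunR f (?C \<phi>)) (FunR f (?C \<psi>))) (FunR f (map2 CompR (?C \<phi>) (?C \<psi>)))"
    using f by (intro req_fun_comp) auto
  moreover have "list_all2 (red_eq R) (map2 CompR (map IdR us) (map IdR us)) (map IdR us)"
    if "\<forall>t\<in>set us. wf_trm R t" for us
    using that by (auto simp: list_all2_conv_all_nth intro!: req_id_left is_red_id)
  then have "list_all2 (red_eq R) (map2 CompR (?C \<phi>) (?C \<psi>)) (?C (CompR \<phi> \<psi>))"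
    using f c by (auto intro!: list_all2_appendI intro: req_refl is_red_comp)
  then have "red_eq R (FunR f (map2 CompR (?C \<phi>) (?C \<psi>))) (FunR f (?C (CompR \<phi> \<psi>)))"
    using f by (intro req_fun_cong) auto
  ultimately show ?thesis by (rule req_trans)
qed

lemma FunR_context_typing:
  assumes f: "f \<in> fsyms R" "length ss + 1 + length ts = arity R f"
    "\<forall>t\<in>set ss \<union> set ts. wf_trm R t"
    and "is_red R \<phi> s t"
  shows "is_red R (FunR f (map IdR ss @ [\<phi>] @ map IdR ts)) (Fn f (ss @ [s] @ ts)) (Fn f (ss @ [t] @ ts))"
  using assms by (intro is_red_fun) (auto simp: nth_append nth_Cons' intro!: is_red_id)

lemma singular_generated_typing: "singular_generated \<phi> \<Longrightarrow> \<exists>s t. is_red R \<phi> s t"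
proof (induction rule: singular_generated.induct)
  case (sgen_eq \<phi> \<psi>)
  then show ?case using red_eq_is_red by blast
qed (blast intro: is_red.intros)+

lemma singular_generated_FunR_context:
  assumes f: "f \<in> fsyms R" "length ss + 1 + length ts = arity R f"
    "\<forall>t\<in>set ss \<union> set ts. wf_trm R t"
    and "singular_generated \<phi>"
  shows "singular_generated (FunR f (map IdR ss @ [\<phi>] @ map IdR ts))"
  using \<open>singular_generated \<phi>\<close>
proof induction
  case (sgen_id s)
  have "red_eq R (FunR f (map IdR (ss @ [s] @ ts))) (IdR (Fn f (ss @ [s] @ ts)))"
    using f sgen_id by (intro req_fun_id) auto
  moreover have "singular_generated (IdR (Fn f (ss @ [s] @ ts)))"
    using f sgen_id by (intro singular_generated.sgen_id) auto
  ultimately show ?case using sgen_eq req_sym by fastforce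
next
  case (sgen_singular \<rho> s t)
  then show ?case
    using FunR_context_typing[OF f] singular_fun[OF f] singular_generated.sgen_singular by blast
next
  case (sgen_comp \<phi> s t \<psi> u)
  then show ?case
    using sgen_eq[OF FunR_context_comp[OF f sgen_comp.hyps(1,2)]]
      singular_generated.sgen_comp[OF FunR_context_typing[OF f sgen_comp.hyps(1)]
        FunR_context_typing[OF f sgen_comp.hyps(2)]]
    by blast
next
  case (sgen_eq \<phi> \<psi>)
  have "list_all2 (red_eq R) (map IdR us) (map IdR us)" if "\<forall>t\<in>set us. wf_trm R t" for us
    using that by (auto simp: list_all2_conv_all_nth intro!: req_refl is_red_id)
  then have "red_eq R (FunR f (map IdR ss @ [\<phi>] @ map IdR ts)) (FunR f (map IdR ss @ [\<psi>] @ map IdR ts))"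
    using f sgen_eq by (intro req_fun_cong list_all2_appendI) auto
  with sgen_eq show ?case using singular_generated.sgen_eq by blast
qed

lemma singular_generated_FunR_prefix:
  assumes f: "f \<in> fsyms R" "length \<phi>s + length us = arity R f"
    "\<forall>t\<in>set us. wf_trm R t" "\<forall>\<phi>\<in>set \<phi>s. singular_generated \<phi>"
  shows "singular_generated (FunR f (\<phi>s @ map IdR us))"
  using assms
proof (induction \<phi>s arbitrary: us rule: rev_induct)
  case Nil
  then have "red_eq R (FunR f (map IdR us)) (IdR (Fn f us))"
    by (intro req_fun_id) auto
  moreover have "singular_generated (IdR (Fn f us))" using Nil by (intro sgen_id) auto
  ultimately show ?case using sgen_eq req_sym by fastforce
next
  case (snoc \<phi> \<phi>s)
  have "\<forall>i. \<exists>s t. i < length \<phi>s \<longrightarrow> is_red R (\<phi>s ! i) s t"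
    using snoc.prems(4) singular_generated_typing by (metis Un_iff nth_mem set_append)
  then obtain S T where ST: "\<And>i. i < length \<phi>s \<Longrightarrow> is_red R (\<phi>s ! i) (S i) (T i)"
    by metis
  define ss where "ss = map S [0..<length \<phi>s]"
  define ts where "ts = map T [0..<length \<phi>s]"
  obtain s t where \<phi>: "is_red R \<phi> s t" using snoc.prems(4) singular_generated_typing[of \<phi>] by auto
  have wf: "\<forall>t\<in>set ts. wf_trm R t" "wf_trm R s" "wf_trm R t"
    using ST[THEN is_red_wf] is_red_wf[OF \<phi>] by (auto simp: ts_def)
  let ?A = "\<phi>s @ map IdR (s # us)" and ?B = "map IdR ts @ [\<phi>] @ map IdR us"
  have A: "singular_generated (FunR f ?A)" using snoc wf by (intro snoc.IH) auto
  have B: "singular_generated (FunR f ?B)"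
    using snoc wf by (intro singular_generated_FunR_context) (auto simp: ts_def)
  have tA: "is_red R (FunR f ?A) (Fn f (ss @ s # us)) (Fn f (ts @ s # us))"
    using snoc.prems wf ST
    by (intro is_red_fun) (auto simp: nth_append nth_Cons' ss_def ts_def intro!: is_red_id)
  have tB: "is_red R (FunR f ?B) (Fn f (ts @ [s] @ us)) (Fn f (ts @ [t] @ us))"
    using snoc.prems wf \<phi> by (intro FunR_context_typing) (auto simp: ts_def)
  have "\<exists>s t u. is_red R (?A ! i) s t \<and> is_red R (?B ! i) t u" if "i < arity R f" for i
  proof -
    have "is_red R (?A ! i) ((ss @ s # us) ! i) ((ts @ s # us) ! i)"
      using snoc.prems wf ST that
      by (auto simp: nth_append nth_Cons' ss_def ts_def intro!: is_red_id)
    moreover have "is_red R (?B ! i) ((ts @ s # us) ! i) ((ts @ t # us) ! i)"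
      using snoc.prems wf \<phi> that
      by (auto simp: nth_append nth_Cons' ts_def intro!: is_red_id)
    ultimately show ?thesis by blast
  qed
  then have "red_eq R (CompR (FunR f ?A) (FunR f ?B)) (FunR f (map2 CompR ?A ?B))"
    using snoc.prems by (intro req_fun_comp) (auto simp: ts_def)
  moreover have "list_all2 (red_eq R) (map2 CompR ?A ?B) ((\<phi>s @ [\<phi>]) @ map IdR us)"
    using snoc.prems wf ST \<phi>
    by (auto simp: list_all2_conv_all_nth nth_append nth_Cons' ts_def
        intro!: req_id_left is_red_id intro: req_id_right)
  then have "red_eq R (FunR f (map2 CompR ?A ?B)) (FunR f ((\<phi>s @ [\<phi>]) @ map IdR us))"
    using snoc.prems by (intro req_fun_cong) (auto simp: ts_def)
  moreover have "singular_generated (CompR (FunR f ?A) (FunR f ?B))"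
    using sgen_comp[OF tA _ A B] tB by simp
  ultimately show ?case using sgen_eq by blast
qed

lemma singular_generated_FunR:
  assumes "f \<in> fsyms R" "length \<phi>s = arity R f" "\<forall>\<phi>\<in>set \<phi>s. singular_generated \<phi>"
  shows "singular_generated (FunR f \<phi>s)"
  using singular_generated_FunR_prefix[of f \<phi>s "[]"] assms by simp

lemma singular_generated_tapp:
  "wf_trm R s \<Longrightarrow> (\<And>x. x \<in> tvars s \<Longrightarrow> singular_generated (\<theta> x))
    \<Longrightarrow> singular_generated (tapp \<theta> s)"
proof (induction s)
  case (Fn f ts)
  then have "singular_generated (tapp \<theta> t)" if "t \<in> set ts" for t
    using that by auto
  with Fn.prems show ?case by (auto intro!: singular_generated_FunR)
qed simp

text \<open>By interchange, \<open>\<tau>(\<phi>\<^sub>1, \<dots>, \<phi>\<^sub>n)\<close> is \<open>s(\<phi>\<^sub>1, \<dots>, \<phi>\<^sub>n)\<close> followed by the singular reduction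
  \<open>\<tau>(1, \<dots>, 1)\<close>, where \<open>s\<close> is the source of \<open>\<tau>\<close>.\<close>

lemma singular_generated_RuleR:
  assumes l: "l \<in> labels R" "length \<phi>s = rule_rank R l" and \<phi>s: "\<forall>\<phi>\<in>set \<phi>s. singular_generated \<phi>"
  shows "singular_generated (RuleR l \<phi>s)"
proof -
  let ?n = "rule_rank R l"
  have "\<forall>i. \<exists>s t. i < ?n \<longrightarrow> is_red R (\<phi>s ! i) s t"
    using \<phi>s l singular_generated_typing by (metis nth_mem)
  then obtain S T where ST: "\<And>i. i < ?n \<Longrightarrow> is_red R (\<phi>s ! i) (S i) (T i)"
    by metis
  define \<theta> where "\<theta> i = (if i < ?n then \<phi>s ! i else IdR (V i))" for i
  define a where "a i = (if i < ?n then S i else V i)" for i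
  define b where "b i = (if i < ?n then T i else V i)" for i
  have \<theta>: "is_red R (\<theta> i) (a i) (b i)" for i
    using ST by (auto simp: \<theta>_def a_def b_def intro!: is_red_id wf_trm.intros)
  have b: "wf_trm R (b i)" for i using \<theta> is_red_wf by blast
  define \<rho> :: "('f, 'l) red" where "\<rho> = RuleR l (map IdR (map V [0..<?n]))"
  have "is_red R \<rho> (tsubst ((!) (map V [0..<?n])) (rule_src R l)) (tsubst ((!) (map V [0..<?n])) (rule_tgt R l))"
    unfolding \<rho>_def using l by (intro is_red_rule) (auto intro!: is_red_id wf_trm.intros)
  moreover have "tsubst ((!) (map V [0..<?n])) (rule_src R l) = tsubst V (rule_src R l)"
    "tsubst ((!) (map V [0..<?n])) (rule_tgt R l) = tsubst V (rule_tgt R l)"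
    using rule_wf[OF l(1)] by (auto intro!: tsubst_cong simp del: tsubst_V)
  ultimately have \<rho>: "is_red R \<rho> (rule_src R l) (rule_tgt R l)" by simp
  have 1: "rsubst b \<rho> \<theta> = RuleR l \<phi>s"
    using l by (auto simp: \<rho>_def \<theta>_def intro!: nth_equalityI)
  have 2: "rsubst b \<rho> (\<lambda>x. IdR (b x)) = RuleR l (map IdR (map b [0..<?n]))"
    by (auto simp: \<rho>_def)
  have "singular R (RuleR l (map IdR (map b [0..<?n])))"
    using l b by (intro singular_rule) auto
  moreover have t2: "is_red R (rsubst b \<rho> (\<lambda>x. IdR (b x))) (tsubst b (rule_src R l)) (tsubst b (rule_tgt R l))"
    by (rule rsubst_typing[OF \<rho>]) (rule is_red_id[OF b])
  ultimately have "singular_generated (rsubst b \<rho> (\<lambda>x. IdR (b x)))"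
    using sgen_singular unfolding 2 by blast
  moreover have "singular_generated (tapp \<theta> (rule_src R l))"
    using rule_wf[OF l(1)] \<phi>s l(2) by (intro singular_generated_tapp) (auto simp: \<theta>_def)
  moreover have "is_red R (tapp \<theta> (rule_src R l)) (tsubst a (rule_src R l)) (tsubst b (rule_src R l))"
    using rule_wf[OF l(1)] \<theta> by (intro tapp_typing)
  ultimately have "singular_generated (CompR (tapp \<theta> (rule_src R l)) (rsubst b \<rho> (\<lambda>x. IdR (b x))))"
    using t2 sgen_comp by blast
  then show ?thesis
    using req_interchange_src[OF \<rho>] \<theta> 1 req_sym sgen_eq by metis
qed

lemma is_red_singular_generated: "is_red R \<phi> s t \<Longrightarrow> singular_generated \<phi>"
proof (induction rule: is_red.induct)
  case (is_red_fun f \<phi>s ss ts)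
  then show ?case by (auto intro!: singular_generated_FunR simp: in_set_conv_nth)
next
  case (is_red_rule l \<phi>s ss ts)
  then show ?case by (auto intro!: singular_generated_RuleR simp: in_set_conv_nth)
qed (auto intro: singular_generated.intros)

definition step :: "'f trm \<Rightarrow> ('f, 'l) red \<Rightarrow> 'f trm \<Rightarrow> bool" where
  "step s \<rho> t \<longleftrightarrow> singular R \<rho> \<and> is_red R \<rho> s t \<and> \<not> is_identity R \<rho>"

lemma identity_or_step:
  assumes "is_red R \<phi> s t"
  shows "is_identity R \<phi> \<or> (\<exists>\<rho> u \<phi>'. step s \<rho> u \<and> is_red R \<phi>' u t \<and> red_eq R \<phi> (CompR \<rho> \<phi>'))"
  using is_red_singular_generated[OF assms] assms
proof (induction arbitrary: s t)
  case (sgen_id w)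
  then show ?case by (auto simp: is_identity_def intro: req_refl is_red_id)
next
  case (sgen_singular \<rho> s' t')
  then show ?case
    unfolding step_def by (meson is_red_id is_red_wf req_id_right req_sym)
next
  case (sgen_comp \<phi> s' t' \<psi> u')
  from is_red_CompE[OF sgen_comp.prems] obtain m where m: "is_red R \<phi> s m" "is_red R \<psi> m t"
    by blast
  consider w where "red_eq R \<phi> (IdR w)"
    | \<rho> u \<phi>' where "step s \<rho> u" "is_red R \<phi>' u m" "red_eq R \<phi> (CompR \<rho> \<phi>')"
    using sgen_comp.IH(1)[OF m(1)] unfolding is_identity_def by blast
  then show ?case
  proof cases
    case 1
    then have "teq R w s" "teq R w m" using red_eq_is_red m is_red_IdE by blast+
    then have \<psi>: "is_red R \<psi> s t" and "red_eq R (IdR w) (IdR s)"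
      using m is_red_change_src req_id_class by (meson teq_sym teq_trans)+
    then have "red_eq R (CompR \<phi> \<psi>) (CompR (IdR s) \<psi>)"
      using m 1 req_comp_cong req_refl req_trans by meson
    then have eq: "red_eq R (CompR \<phi> \<psi>) \<psi>"
      using req_id_left[OF \<psi>] req_trans by blast
    then show ?thesis
      using sgen_comp.IH(2)[OF \<psi>] req_trans unfolding is_identity_def by blast
  next
    case 2
    then have \<rho>: "is_red R \<rho> s u" by (simp add: step_def)
    have "red_eq R (CompR \<phi> \<psi>) (CompR (CompR \<rho> \<phi>') \<psi>)"
      using m 2 req_comp_cong req_refl by meson
    then have "red_eq R (CompR \<phi> \<psi>) (CompR \<rho> (CompR \<phi>' \<psi>))"
      using req_assoc[OF \<rho> 2(2) m(2)] req_trans by blast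
    then show ?thesis using 2 m is_red_comp by blast
  qed
next
  case (sgen_eq \<phi> \<psi>)
  then have "is_red R \<phi> s t" using red_eq_is_red req_sym by blast
  from sgen_eq.IH[OF this] show ?case
    using sgen_eq.hyps(1) req_sym req_trans unfolding is_identity_def by blast
qed

definition normal :: "'f trm \<Rightarrow> bool" where
  "normal s \<longleftrightarrow> wf_trm R s \<and> (\<nexists>\<rho> t. step s \<rho> t)"

lemma red_eq_comp_left:
  "is_red R \<rho> s t \<Longrightarrow> red_eq R \<phi> \<psi> \<Longrightarrow> is_red R \<phi> t u \<Longrightarrow> red_eq R (CompR \<rho> \<phi>) (CompR \<rho> \<psi>)"
  by (meson req_comp_cong req_refl)

lemma red_eq_comp_right:
  "red_eq R \<phi> \<psi> \<Longrightarrow> is_red R \<phi> s t \<Longrightarrow> is_red R \<rho> t u \<Longrightarrow> red_eq R (CompR \<phi> \<rho>) (CompR \<psi> \<rho>)"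
  by (meson req_comp_cong req_refl)

context
  assumes sn: "terminating R"
begin

lemma wfp_step: "wfp (\<lambda>t s. \<exists>\<rho>. step s \<rho> t)"
proof -
  have False if "\<And>n. \<exists>\<rho>. step (t n) \<rho> (t (Suc n))" for t
  proof -
    from that obtain \<rho> where "\<And>n. step (t n) (\<rho> n) (t (Suc n))" by metis
    then have "{n::nat. \<not> is_identity R (\<rho> n)} = UNIV"
      and "\<And>n. singular R (\<rho> n) \<and> is_red R (\<rho> n) (t n) (t (Suc n))"
      by (auto simp: step_def)
    with sn show False
      unfolding terminating_def by (metis infinite_UNIV_nat)
  qed
  then show ?thesis
    unfolding wfp_def wf_iff_no_infinite_down_chain by (simp, metis)
qed

lemma normal_form_exists: "wf_trm R s \<Longrightarrow> \<exists>n \<nu>. normal n \<and> is_red R \<nu> s n"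
proof (induction s rule: wfp_induct_rule[OF wfp_step])
  case (1 s)
  show ?case
  proof (cases "normal s")
    case True
    then show ?thesis using 1 is_red_id by blast
  next
    case False
    then obtain \<rho> t where "step s \<rho> t" using 1 by (auto simp: normal_def)
    moreover from this have "is_red R \<rho> s t" by (simp add: step_def)
    ultimately show ?thesis using 1 is_red_wf is_red_comp by meson
  qed
qed

lemma normal_form_unique:
  assumes lcc: "locally_commuting_confluent R"
  shows "is_red R \<phi> s m \<Longrightarrow> is_red R \<psi> s n \<Longrightarrow> normal m \<Longrightarrow> normal n \<Longrightarrow> red_eq R \<phi> \<psi>"
proof (induction s arbitrary: \<phi> \<psi> m n rule: wfp_induct_rule[OF wfp_step])
  case (1 s)
  have no_step: False
    if \<chi>: "is_red R \<chi> s k" "is_identity R \<chi>" "normal k" "step s \<rho> u" for \<chi> k \<rho> u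
  proof -
    obtain w where "red_eq R \<chi> (IdR w)" using \<chi> by (auto simp: is_identity_def)
    then have "teq R s k" using \<chi> red_eq_is_red is_red_IdE teq_sym teq_trans by meson
    then have "step k \<rho> u" using \<chi> is_red_change_src unfolding step_def by blast
    with \<chi> show False by (auto simp: normal_def)
  qed
  consider "is_identity R \<phi>" "is_identity R \<psi>"
    | "is_identity R \<phi>" "\<exists>\<rho> u. step s \<rho> u" | "is_identity R \<psi>" "\<exists>\<rho> u. step s \<rho> u"
    | \<rho> u \<phi>' \<rho>' u' \<psi>' where "step s \<rho> u" "is_red R \<phi>' u m" "red_eq R \<phi> (CompR \<rho> \<phi>')"
        "step s \<rho>' u'" "is_red R \<psi>' u' n" "red_eq R \<psi> (CompR \<rho>' \<psi>')"
    using identity_or_step[OF 1(2)] identity_or_step[OF 1(3)] by blast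
  then show ?case
  proof cases
    case 1
    then obtain v w where vw: "red_eq R \<phi> (IdR v)" "red_eq R \<psi> (IdR w)"
      by (auto simp: is_identity_def)
    then have "teq R v s" "teq R w s"
      using "1.prems" red_eq_is_red is_red_IdE by blast+
    then have "red_eq R (IdR v) (IdR w)" by (meson req_id_class teq_sym teq_trans)
    with vw show ?thesis by (meson req_sym req_trans)
  next
    case 2
    then show ?thesis using no_step "1.prems" by blast
  next
    case 3
    then show ?thesis using no_step "1.prems" by blast
  next
    case 4
    then have \<rho>: "is_red R \<rho> s u" "singular R \<rho>" and \<rho>': "is_red R \<rho>' s u'" "singular R \<rho>'"
      by (simp_all add: step_def)
    then obtain t \<alpha> \<beta> where j: "is_red R \<alpha> u t" "is_red R \<beta> u' t"
      "red_eq R (CompR \<rho> \<alpha>) (CompR \<rho>' \<beta>)"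
      using lcc unfolding locally_commuting_confluent_def commuting_joinable_def by meson
    obtain k \<nu> where \<nu>: "normal k" "is_red R \<nu> t k"
      using normal_form_exists j is_red_wf by meson
    have "red_eq R \<phi>' (CompR \<alpha> \<nu>)"
      using "1.IH" 4 j \<nu> "1.prems" is_red_comp by meson
    then have "red_eq R \<phi> (CompR \<rho> (CompR \<alpha> \<nu>))"
      using 4 \<rho> red_eq_comp_left req_trans by meson
    then have \<phi>: "red_eq R \<phi> (CompR (CompR \<rho> \<alpha>) \<nu>)"
      using req_assoc[OF \<rho>(1) j(1) \<nu>(2)] req_sym req_trans by meson
    have "red_eq R \<psi>' (CompR \<beta> \<nu>)"
      using "1.IH" 4 j \<nu> "1.prems" is_red_comp by meson
    then have "red_eq R \<psi> (CompR \<rho>' (CompR \<beta> \<nu>))"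
      using 4 \<rho>' red_eq_comp_left req_trans by meson
    then have \<psi>: "red_eq R \<psi> (CompR (CompR \<rho>' \<beta>) \<nu>)"
      using req_assoc[OF \<rho>'(1) j(2) \<nu>(2)] req_sym req_trans by meson
    have "red_eq R (CompR (CompR \<rho> \<alpha>) \<nu>) (CompR (CompR \<rho>' \<beta>) \<nu>)"
      using red_eq_comp_right[OF j(3) is_red_comp[OF \<rho>(1) j(1)] \<nu>(2)] .
    with \<phi> \<psi> show ?thesis by (meson req_sym req_trans)
  qed
qed

lemma parallel_red_eq:
  assumes "monic R" "locally_commuting_confluent R" and \<phi>: "is_red R \<phi> s t" and \<psi>: "is_red R \<psi> s t"
  shows "red_eq R \<phi> \<psi>"
proof -
  obtain n \<nu> where \<nu>: "normal n" "is_red R \<nu> t n"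
    using normal_form_exists \<phi> is_red_wf by meson
  then have "red_eq R (CompR \<phi> \<nu>) (CompR \<psi> \<nu>)"
    using normal_form_unique[OF assms(2) is_red_comp[OF \<phi>] is_red_comp[OF \<psi>]] by blast
  with assms \<nu> show ?thesis unfolding monic_def by blast
qed

end

end

theorem theorem4p2p5:
  fixes R :: "('f, 'l) rw2"
  assumes "rewriting_2_theory R"
    and "finitely_presented R"
    and "monic R"
    and "terminating R"
    and "locally_commuting_confluent R"
  shows "mac_lane_coherent R"
  using parallel_red_eq[OF assms(1,4,3,5)] unfolding mac_lane_coherent_def by blast

end
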